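(* Let $A$ be a partially ordered set with $N$ elements, let $\Xi_N=\{\xi_1<\dots<\xi_N\}\subset\Xi$, let $B=\{\beta_1,\dots,\beta_n\}\subset A$, $n\le N$, and let $F$, $S(B,f)$, $\Pi_k$, $\Pi^k$ be as defined in the context. If $|\Pi_1|\le|\Pi_2|\le\dots\le|\Pi_n|$ and $\Pi_k\cap\Pi_j=\emptyset$ for all $k\ne j$, then $$\min_{f\in F}S(B,f)=\sum_{k=1}^n\xi_{\sum_{j=1}^k|\Pi_j|}.$$ If $|\Pi^1|\le|\Pi^2|\le\dots\le|\Pi^n|$ and $\Pi^k\cap\Pi^j=\emptyset$ for all $k\ne j$, then $$\max_{f\in F}S(B,f)=\sum_{k=1}^n\xi_{N-\sum_{j=1}^k|\Pi^j|+1}.$$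
   Context: $N\in\mathbb{N}$ and $A=\{\alpha_1,\dots,\alpha_N\}$ is a set of $N$ elements with a partial order $\preceq$. $\Xi$ is a linearly ordered set with order $\le$ and a commutative associative binary operation $+$ such that for all $\xi,\eta,\zeta\in\Xi$, $\xi<\eta$ implies $\xi+\zeta<\eta+\zeta$. $\Xi_N=\{\xi_1,\dots,\xi_N\}\subset\Xi$ is a subset of $N$ different elements $\xi_1<\xi_2<\dots<\xi_N$. $F$ is the set of all bijections $f\colon A\to\Xi_N$ that are non-decreasing, i.e. $\alpha\preceq\beta$ implies $f(\alpha)\le f(\beta)$. $B=\{\beta_1,\dots,\beta_n\}$ is a fixed set of $n$ distinct elements of $A$, and for $f\in F$, $S(B,f)=\sum_{k=1}^n f(\beta_k)$ (sum with respect to $+$ in $\Xi$). For $k=1,\dots,n$, $\Pi_k=\{\beta\in A\colon\beta\preceq\beta_k\}$ and $\Pi^k=\{\beta\in A\colon\beta_k\preceq\beta\}$. $|C|$ is the number of elements of a finite set $C$. *)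

theory Defs
  imports Complex_Main "HOL-Library.FuncSet" "HOL-Library.Disjoint_Sets"
begin

text \<open>
  A partial order on a carrier \<open>A\<close> is a relation \<open>r\<close> with \<open>partial_order_on A r\<close>, where
  \<open>(a, b) \<in> r\<close> means that \<open>a\<close> precedes or equals \<open>b\<close>. This includes \<open>r \<subseteq> A \<times> A\<close>, so
  \<open>under r b\<close> is the set of all \<open>a \<in> A\<close> below \<open>b\<close>, and \<open>above r b\<close> the set of all
  \<open>a \<in> A\<close> above \<open>b\<close>.

  Maps on \<open>A\<close> are taken extensional (\<open>undefined\<close> outside \<open>A\<close>), so that they correspond exactly
  to set-theoretic functions \<open>A \<rightarrow> X\<close>.
\<close>

definition nondecreasing_bijections :: "'a set \<Rightarrow> 'a rel \<Rightarrow> 'b::linorder set \<Rightarrow> ('a \<Rightarrow> 'b) set"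
  where "nondecreasing_bijections A r X =
    {f \<in> A \<rightarrow>\<^sub>E X. bij_betw f A X \<and> (\<forall>a\<in>A. \<forall>b\<in>A. (a, b) \<in> r \<longrightarrow> f a \<le> f b)}"

text \<open>
  \<open>semigroup_sum g n = g 1 + \<dots> + g n\<close> for \<open>n \<ge> 1\<close>. The operator \<open>sum\<close> is not available, since the
  addition need not have a neutral element; for the same reason the value at \<open>0\<close> is unspecified.
\<close>

primrec semigroup_sum :: "(nat \<Rightarrow> 'b::ab_semigroup_add) \<Rightarrow> nat \<Rightarrow> 'b"
  where
    "semigroup_sum g 0 = undefined"
  | "semigroup_sum g (Suc n) = (if n = 0 then g 1 else semigroup_sum g n + g (Suc n))"

lemma semigroup_sum_eq_sum:
  fixes g :: "nat \<Rightarrow> 'b::comm_monoid_add"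
  assumes "n \<ge> 1"
  shows "semigroup_sum g n = (\<Sum>k=1..n. g k)"
  using assms by (induction n rule: nat_induct_at_least) simp_all

text \<open>
  \<open>Min\<close> and \<open>Max\<close> are meaningful only for finite nonempty sets. The set of nondecreasing bijections
  is both: finiteness is clear, and a member is obtained by listing \<open>A\<close> by increasing size of the
  sets \<open>under r a\<close>.
\<close>

lemma finite_nondecreasing_bijections:
  assumes "finite A" "finite X"
  shows "finite (nondecreasing_bijections A r X)"
  by (rule finite_subset[OF _ finite_PiE[OF assms(1), of "\<lambda>_. X"]])
    (auto simp: nondecreasing_bijections_def assms)

lemma nondecreasing_bijections_nonempty:
  fixes X :: "'b::linorder set"
  assumes fin: "finite A" "finite X" and card: "card X = card A" and po: "partial_order_on A r"
  shows "nondecreasing_bijections A r X \<noteq> {}"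
proof -
  define h where "h a = card (under r a)" for a
  have rA: "r \<subseteq> A \<times> A" and rf: "refl_on A r" and tr: "trans r" and anti: "antisym r"
    using po by (auto simp: partial_order_on_def preorder_on_def)
  have h_less: "h a < h b" if ab: "(a, b) \<in> r" "a \<noteq> b" for a b
    unfolding h_def
  proof (rule psubset_card_mono)
    show "finite (under r b)"
      using rA fin(1) by (auto simp: under_def intro: finite_subset[of _ A])
    have "under r a \<subseteq> under r b"
      using ab tr by (auto simp: under_def dest: transD)
    moreover have "b \<in> under r b"
      using ab rA rf by (auto simp: under_def refl_on_def)
    moreover have "b \<notin> under r a"
      using ab anti by (auto simp: under_def dest: antisymD)
    ultimately show "under r a \<subset> under r b" by blast
  qed
  obtain zs where zs: "set zs = A" "distinct zs"
    using finite_distinct_list[OF fin(1)] by blast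
  define ys where "ys = sort_key h zs"
  define xs where "xs = sorted_list_of_set X"
  have ys: "set ys = A" "distinct ys" "sorted (map h ys)"
    using zs by (simp_all add: ys_def)
  have xs: "set xs = X" "distinct xs" "sorted xs"
    using fin by (simp_all add: xs_def)
  have len: "length xs = length ys"
    using xs ys card by (metis distinct_card)
  have b_ys: "bij_betw ((!) ys) {..<length ys} A"
    using ys by (simp add: bij_betw_nth)
  have b_xs: "bij_betw ((!) xs) {..<length ys} X"
    using xs len by (simp add: bij_betw_nth)
  define idx where "idx = the_inv_into {..<length ys} ((!) ys)"
  have bi: "bij_betw idx A {..<length ys}"
    unfolding idx_def by (rule bij_betw_the_inv_into[OF b_ys])
  have idx: "idx a < length ys" "ys ! idx a = a" if "a \<in> A" for a
  proof -
    show "idx a < length ys"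
      using bi that by (auto simp: bij_betw_def)
    show "ys ! idx a = a"
      unfolding idx_def using b_ys that by (intro f_the_inv_into_f_bij_betw) auto
  qed
  define f where "f = restrict (\<lambda>a. xs ! idx a) A"
  have "bij_betw (\<lambda>a. xs ! idx a) A X"
    using bij_betw_trans[OF bi b_xs] by (simp add: comp_def)
  then have bf: "bij_betw f A X"
    unfolding f_def by (subst bij_betw_restrict_eq)
  moreover have "f a \<le> f b" if "a \<in> A" "b \<in> A" "(a, b) \<in> r" for a b
  proof (cases "a = b")
    case False
    have "idx a \<le> idx b"
    proof (rule ccontr)
      assume "\<not> idx a \<le> idx b"
      then have "h (ys ! idx b) \<le> h (ys ! idx a)"
        using sorted_nth_mono[OF ys(3), of "idx b" "idx a"] idx(1)[OF that(1)] by simp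
      then show False
        using h_less[OF that(3) False] idx that by simp
    qed
    then show ?thesis
      using that idx(1)[OF that(2)] len sorted_nth_mono[OF xs(3)] by (simp add: f_def)
  qed simp
  moreover have "f \<in> A \<rightarrow>\<^sub>E X"
    using bf by (auto simp: f_def bij_betw_def)
  ultimately have "f \<in> nondecreasing_bijections A r X"
    by (simp add: nondecreasing_bijections_def)
  then show ?thesis by blast
qed

end

theory Submission
  imports Defs
begin

text \<open>
  For the minimum, list the elements of \<open>B\<close> by increasing value of \<open>f\<close>. The sets \<open>\<Pi>\<close> of the first
  \<open>k\<close> of them are disjoint and carry values at most that of the \<open>k\<close>-th, whose rank is therefore at
  least the sum of \<open>k\<close> of the cardinalities, hence at least the sum of the \<open>k\<close> smallest ones.
  Equality is attained by numbering \<open>\<Pi>\<^sub>1\<close> first, then \<open>\<Pi>\<^sub>2\<close>, and so on. This argument works for any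
  order \<open>le\<close> compatible with the addition; the maximum is the case of the dual order on \<open>\<Xi>\<close> and the
  converse relation on \<open>A\<close>.
\<close>

section \<open>Sums in a commutative semigroup\<close>

lemma semigroup_sum_cong:
  assumes "\<And>k. k \<in> {1..n} \<Longrightarrow> f k = g k" "n \<ge> 1"
  shows "semigroup_sum f n = semigroup_sum g n"
  using assms(2,1) by (induction n rule: nat_induct_at_least) simp_all

text \<open>
  A semigroup has no empty sum; starting the fold at an arbitrary \<open>z\<close>, which is cancelled in the end,
  makes sums over arbitrary finite index sets available.
\<close>

definition sum_from :: "'b::ab_semigroup_add \<Rightarrow> ('i \<Rightarrow> 'b) \<Rightarrow> 'i set \<Rightarrow> 'b"
  where "sum_from z h = Finite_Set.fold (\<lambda>k. (+) (h k)) z"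

lemma sum_from_empty [simp]: "sum_from z h {} = z"
  by (simp add: sum_from_def)

lemma sum_from_insert [simp]:
  assumes "finite I" "i \<notin> I"
  shows "sum_from z h (insert i I) = h i + sum_from z h I"
proof -
  interpret comp_fun_commute "\<lambda>k. (+) (h k)"
    by unfold_locales (simp add: fun_eq_iff add.left_commute)
  show ?thesis
    unfolding sum_from_def using assms by (rule fold_insert)
qed

lemma sum_from_atLeast1:
  assumes "n \<ge> 1"
  shows "sum_from z h {1..n} = semigroup_sum h n + z"
  using assms
proof (induction n rule: nat_induct_at_least)
  case base
  have "{1..1::nat} = insert 1 {}" by auto
  then show ?case by simp
next
  case (Suc n)
  then show ?case
    by (simp add: atLeastAtMostSuc_conv add_ac)
qed

section \<open>Comparing sums through ranks\<close>

text \<open>Induction that removes the largest index \<open>i\<close> of \<open>I\<close>: since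
  \<open>I\<close> lies in \<open>{1..i}\<close>, \<open>card I\<close> is at most \<open>i\<close>,
  so \<open>p i\<close> dominates the last summand on the left.\<close>

lemma sum_atLeast1_card_le:
  fixes p :: "nat \<Rightarrow> nat"
  assumes "mono_on {1..m} p" "I \<subseteq> {1..m}"
  shows "(\<Sum>j=1..card I. p j) \<le> (\<Sum>j\<in>I. p j)"
  using assms(2)
proof (induction "card I" arbitrary: I)
  case (Suc c)
  have fin: "finite I" and ne: "I \<noteq> {}"
    using Suc(2,3) finite_subset by auto
  define i where "i = Max I"
  have i: "i \<in> I" and max: "\<And>j. j \<in> I \<Longrightarrow> j \<le> i"
    using fin ne by (auto simp: i_def)
  have "card I \<le> card {1..i}"
    using Suc(3) max by (intro card_mono) auto
  then have "p (Suc c) \<le> p i"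
    using i Suc(2,3) by (intro mono_onD[OF assms(1)]) auto
  moreover have "(\<Sum>j=1..c. p j) \<le> (\<Sum>j\<in>I - {i}. p j)"
  proof -
    have c: "c = card (I - {i})" using Suc(2) i fin by simp
    have "I - {i} \<subseteq> {1..m}" using Suc(3) by blast
    from Suc(1)[OF c this] show ?thesis unfolding c .
  qed
  ultimately show ?case
    unfolding Suc(2)[symmetric] sum.remove[OF fin i] by simp
qed simp

text \<open>Induction that removes an index \<open>i\<close> with \<open>v i\<close> maximal. The
  rank hypothesis at \<open>i\<close> then sums over all of \<open>I\<close>, so \<open>v i\<close>
  is at least the partial sum of the first \<open>card I\<close> values of \<open>p\<close>.
  Removing \<open>i\<close> only shrinks the sums in the remaining rank hypotheses.\<close>

lemma sum_from_le_if_rank_ge: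
  fixes le :: "'b::ab_semigroup_add \<Rightarrow> 'b \<Rightarrow> bool" and p v :: "nat \<Rightarrow> nat"
  assumes refl: "reflp le" and trans: "transp le"
    and add: "\<And>x y z. le x y \<Longrightarrow> le (x + z) (y + z)"
    and h: "\<And>i j. i \<in> {1..N} \<Longrightarrow> j \<in> {1..N} \<Longrightarrow> i \<le> j \<Longrightarrow> le (h i) (h j)"
    and p: "mono_on {1..m} p" "\<And>j. j \<in> {1..m} \<Longrightarrow> p j \<ge> 1"
    and I: "I \<subseteq> {1..m}" and v: "v ` I \<subseteq> {1..N}"
    and rank: "\<And>i. i \<in> I \<Longrightarrow> (\<Sum>j\<in>{j\<in>I. v j \<le> v i}. p j) \<le> v i"
  shows "le (sum_from z (\<lambda>k. h (\<Sum>j=1..k. p j)) {1..card I}) (sum_from z (\<lambda>i. h (v i)) I)"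
  using I v rank
proof (induction "card I" arbitrary: I)
  case 0
  then have "I = {}" using finite_subset by fastforce
  then show ?case using refl by (simp add: reflpD)
next
  case (Suc c)
  let ?P = "\<lambda>k. \<Sum>j=1..k. p j"
  have fin: "finite I" and ne: "I \<noteq> {}"
    using Suc(2,3) finite_subset by auto
  have "Max (v ` I) \<in> v ` I"
    using fin ne by (intro Max_in) auto
  then obtain i where i: "i \<in> I" "v i = Max (v ` I)" by auto
  have max: "v j \<le> v i" if "j \<in> I" for j
    using that fin i(2) by simp
  have "?P (Suc c) \<le> (\<Sum>j\<in>I. p j)"
    using sum_atLeast1_card_le[OF p(1) Suc(3)] Suc(2) by simp
  also have "\<dots> = (\<Sum>j\<in>{j\<in>I. v j \<le> v i}. p j)"
    using max by (intro sum.cong) auto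
  also have "\<dots> \<le> v i"
    using Suc(5) i by blast
  finally have le_v: "?P (Suc c) \<le> v i" .
  \<comment> \<open>Monotonicity of \<open>h\<close> is available only on \<open>{1..N}\<close>, so
    the partial sum must also be shown to be at least 1; its upper bound comes from
    \<open>v i\<close>.\<close>
  have "Suc c \<in> {1..m}"
    using card_mono[OF _ Suc(3)] Suc(2) by simp
  then have "1 \<le> ?P (Suc c)"
    using p(2)[of "Suc c"] by simp
  moreover have "v i \<in> {1..N}" using Suc(4) i(1) by blast
  ultimately have top: "le (h (?P (Suc c))) (h (v i))"
    using le_v by (intro h) (simp_all del: sum.cl_ivl_Suc)
  have "le (sum_from z (\<lambda>k. h (?P k)) {1..card (I - {i})}) (sum_from z (\<lambda>i. h (v i)) (I - {i}))"
  proof (rule Suc(1))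
    show "c = card (I - {i})" using Suc(2) i fin by simp
    show "(\<Sum>j\<in>{j\<in>I - {i}. v j \<le> v k}. p j) \<le> v k" if "k \<in> I - {i}" for k
    proof -
      have "(\<Sum>j\<in>{j\<in>I - {i}. v j \<le> v k}. p j) \<le> (\<Sum>j\<in>{j\<in>I. v j \<le> v k}. p j)"
        using fin by (intro sum_mono2) auto
      also have "\<dots> \<le> v k" using Suc(5) that by blast
      finally show ?thesis .
    qed
    show "I - {i} \<subseteq> {1..m}" "v ` (I - {i}) \<subseteq> {1..N}" using Suc(3,4) by blast+
  qed
  moreover have "card (I - {i}) = c" using Suc(2) i fin by simp
  ultimately have rest: "le (sum_from z (\<lambda>k. h (?P k)) {1..c}) (sum_from z (\<lambda>i. h (v i)) (I - {i}))"
    by simp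
  have "le (h (?P (Suc c)) + sum_from z (\<lambda>k. h (?P k)) {1..c})
           (h (v i) + sum_from z (\<lambda>k. h (?P k)) {1..c})"
    by (rule add[OF top])
  moreover have "le (h (v i) + sum_from z (\<lambda>k. h (?P k)) {1..c})
           (h (v i) + sum_from z (\<lambda>i. h (v i)) (I - {i}))"
    using add[OF rest, of "h (v i)"] unfolding add.commute[of _ "h (v i)"] .
  ultimately have step: "le (h (?P (Suc c)) + sum_from z (\<lambda>k. h (?P k)) {1..c})
           (h (v i) + sum_from z (\<lambda>i. h (v i)) (I - {i}))"
    using trans by (rule transpD[rotated 1])
  have I_eq: "sum_from z (\<lambda>i. h (v i)) I = h (v i) + sum_from z (\<lambda>i. h (v i)) (I - {i})"
    by (rule sum_from_insert[of "I - {i}" i, unfolded insert_Diff[OF i(1)]]) (use fin in simp_all)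
  have ivl: "{1..card I} = insert (Suc c) {1..c}"
    unfolding Suc(2)[symmetric] by auto
  have ivl_eq: "sum_from z (\<lambda>k. h (?P k)) {1..card I}
      = h (?P (Suc c)) + sum_from z (\<lambda>k. h (?P k)) {1..c}"
    unfolding ivl by (rule sum_from_insert) simp_all
  show ?case
    unfolding I_eq ivl_eq by (rule step)
qed

section \<open>Ranks and lower sets\<close>

text \<open>The lower sets in question are disjoint, and the injective map \<open>g\<close> sends
  their union into \<open>{1..g b}\<close>, so counting gives the bound. This supplies the rank
  hypothesis of \<open>sum_from_le_if_rank_ge\<close>.\<close>

lemma sum_card_under_le_rank:
  fixes g :: "'a \<Rightarrow> nat" and \<beta> :: "nat \<Rightarrow> 'a"
  assumes "finite A" "r \<subseteq> A \<times> A" "bij_betw g A {1..card A}"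
    and mono: "\<And>a b. (a, b) \<in> r \<Longrightarrow> g a \<le> g b"
    and disj: "disjoint_family_on (\<lambda>k. under r (\<beta> k)) {1..n}"
    and b: "b \<in> A"
  shows "(\<Sum>j\<in>{j\<in>{1..n}. g (\<beta> j) \<le> g b}. card (under r (\<beta> j))) \<le> g b"
proof -
  let ?J = "{j\<in>{1..n}. g (\<beta> j) \<le> g b}"
  have sub: "under r c \<subseteq> A" for c
    using assms(2) by (auto simp: under_def)
  have "(\<Sum>j\<in>?J. card (under r (\<beta> j))) = card (\<Union>j\<in>?J. under r (\<beta> j))"
  proof (rule card_UN_disjoint[symmetric])
    show "\<forall>j\<in>?J. finite (under r (\<beta> j))"
      using finite_subset[OF sub assms(1)] by blast
    show "\<forall>i\<in>?J. \<forall>j\<in>?J. i \<noteq> j \<longrightarrow> under r (\<beta> i) \<inter> under r (\<beta> j) = {}"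
      using disj by (simp add: disjoint_family_on_def)
  qed simp
  also have "\<dots> = card (g ` (\<Union>j\<in>?J. under r (\<beta> j)))"
  proof (rule card_image[symmetric])
    show "inj_on g (\<Union>j\<in>?J. under r (\<beta> j))"
      using bij_betw_imp_inj_on[OF assms(3)] sub by (meson UN_least inj_on_subset)
  qed
  also have "\<dots> \<le> card {1..g b}"
  proof (rule card_mono)
    show "g ` (\<Union>j\<in>?J. under r (\<beta> j)) \<subseteq> {1..g b}"
    proof clarsimp
      fix j a assume "g (\<beta> j) \<le> g b" "a \<in> under r (\<beta> j)"
      moreover from this have "g a \<le> g (\<beta> j)" "a \<in> A"
        using mono sub by (auto simp: under_def)
      moreover from this have "g a \<in> {1..card A}"
        using assms(3) by (auto simp: bij_betw_def)
      ultimately show "Suc 0 \<le> g a \<and> g a \<le> g b" by simp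
    qed
  qed simp
  finally show ?thesis by simp
qed

text \<open>An element not below \<open>b\<close> lies above it and has a larger number, so the
  numbers up to \<open>g b\<close> are taken exactly on \<open>under r b\<close>.\<close>

lemma rank_eq_card_under:
  fixes g :: "'a \<Rightarrow> nat"
  assumes r: "r \<subseteq> A \<times> A" and g: "bij_betw g A {1..card A}"
    and mono: "\<And>a b. (a, b) \<in> r \<Longrightarrow> g a \<le> g b"
    and b: "b \<in> A" and comparable: "\<And>a. a \<in> A \<Longrightarrow> (a, b) \<in> r \<or> (b, a) \<in> r"
    and "(b, b) \<in> r"
  shows "g b = card (under r b)"
proof -
  have inj: "inj_on g A" and img: "g ` A = {1..card A}"
    using g by (auto simp: bij_betw_def)
  have "g ` under r b = {1..g b}"
  proof (intro equalityI subsetI)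
    fix x assume "x \<in> g ` under r b"
    then obtain a where "(a, b) \<in> r" "x = g a" by (auto simp: under_def)
    then show "x \<in> {1..g b}" using mono img r by fastforce
  next
    fix x assume x: "x \<in> {1..g b}"
    have "g b \<in> {1..card A}" using img b by blast
    with x have "x \<in> g ` A" using img by simp
    then obtain a where a: "a \<in> A" "x = g a" by auto
    have "(a, b) \<in> r"
    proof (cases "(b, a) \<in> r")
      case True
      then have "g a = g b" using mono x a by fastforce
      then have "a = b" using inj a b by (auto dest: inj_onD)
      then show ?thesis using assms(6) by simp
    next
      case False
      then show ?thesis using comparable[OF a(1)] by simp
    qed
    then show "x \<in> g ` under r b" using a by (auto simp: under_def)
  qed
  then have "card (g ` under r b) = g b" by simp
  moreover have "inj_on g (under r b)"
    using inj r by (auto simp: under_def intro: inj_on_subset)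
  ultimately show ?thesis by (simp add: card_image)
qed

text \<open>
  The order is enlarged so that every element of \<open>under r (\<beta> k)\<close> precedes all elements outside the
  first \<open>k\<close> of these sets; then \<open>\<beta> k\<close> is comparable to everything and its rank is forced.
\<close>

lemma obtain_block_numbering:
  fixes \<beta> :: "nat \<Rightarrow> 'a"
  assumes fin: "finite A" and po: "partial_order_on A r"
    and \<beta>: "\<beta> ` {1..n} \<subseteq> A"
    and disj: "disjoint_family_on (\<lambda>k. under r (\<beta> k)) {1..n}"
  obtains g :: "'a \<Rightarrow> nat"
  where "bij_betw g A {1..card A}" "\<And>a b. (a, b) \<in> r \<Longrightarrow> g a \<le> g b"
    "\<And>k. k \<in> {1..n} \<Longrightarrow> g (\<beta> k) = (\<Sum>j=1..k. card (under r (\<beta> j)))"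
proof -
  have rA: "r \<subseteq> A \<times> A" and rf: "refl_on A r" and tr: "trans r" and anti: "antisym r"
    using po by (auto simp: partial_order_on_def preorder_on_def)
  \<comment> \<open>By disjointness at most one lower set contains \<open>a\<close>, and
    \<open>block a\<close> is its index. The alternative \<open>Suc n\<close> makes the
    \<open>LEAST\<close> well defined and puts the elements outside all lower sets last.\<close>
  define block where
    "block a = (LEAST k. k = Suc n \<or> k \<in> {1..n} \<and> a \<in> under r (\<beta> k))" for a
  have block_eq: "block a = k" if "k \<in> {1..n}" "a \<in> under r (\<beta> k)" for a k
    unfolding block_def
  proof (rule Least_equality)
    fix j assume "j = Suc n \<or> j \<in> {1..n} \<and> a \<in> under r (\<beta> j)"
    then show "k \<le> j"
    proof
      assume "j \<in> {1..n} \<and> a \<in> under r (\<beta> j)"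
      then have "j = k"
        using that disjoint_family_onD[OF disj, of j k] by auto
      then show ?thesis by simp
    qed (use that in simp)
  qed (use that in simp)
  have block_le: "block a \<le> Suc n" for a
    unfolding block_def by (rule Least_le) simp
  have block_cases: "block a = Suc n \<or> block a \<in> {1..n} \<and> a \<in> under r (\<beta> (block a))" for a
    unfolding block_def by (rule LeastI[of _ "Suc n"]) simp
  \<comment> \<open>Each \<open>under r (\<beta> k)\<close> is closed downwards, so a predecessor of
    one of its elements has the same block. Hence \<open>r\<close> never contradicts the comparison
    of blocks added in \<open>s\<close>.\<close>
  have block_mono: "block a \<le> block b" if "(a, b) \<in> r" for a b
  proof (cases "block b = Suc n")
    case False
    then have "block b \<in> {1..n}" "b \<in> under r (\<beta> (block b))"
      using block_cases[of b] by auto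
    then have "block a = block b"
      using that tr by (intro block_eq) (auto simp: under_def dest: transD)
    then show ?thesis by simp
  qed (use block_le in simp)
  define s where "s = r \<union> {(a, b) \<in> A \<times> A. block a < block b}"
  have sA: "s \<subseteq> A \<times> A" using rA by (auto simp: s_def)
  have "refl_on A s" using rf by (auto simp: s_def refl_on_def)
  \<comment> \<open>If the block increases from \<open>a\<close> to \<open>c\<close>, the pair is in
    \<open>s\<close> by definition; otherwise all three blocks agree and both pairs come from
    \<open>r\<close>.\<close>
  moreover have "trans s"
  proof (rule transI)
    fix a b c assume ab: "(a, b) \<in> s" and bc: "(b, c) \<in> s"
    have "block a \<le> block b" "block b \<le> block c"
      using ab bc block_mono by (auto simp: s_def less_imp_le)
    moreover have "a \<in> A" "c \<in> A" using ab bc sA by auto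
    ultimately show "(a, c) \<in> s"
      using ab bc transD[OF tr, of a b c] by (auto simp: s_def)
  qed
  moreover have "antisym s"
  proof (rule antisymI)
    fix a b assume "(a, b) \<in> s" "(b, a) \<in> s"
    then show "a = b"
      using anti block_mono[of a b] block_mono[of b a] by (auto simp: s_def dest: antisymD)
  qed
  ultimately have "partial_order_on A s"
    using sA by (simp add: partial_order_on_def preorder_on_def)
  then have "nondecreasing_bijections A s {1..card A} \<noteq> {}"
    using fin by (intro nondecreasing_bijections_nonempty) auto
  then obtain g where g: "g \<in> nondecreasing_bijections A s {1..card A}" by blast
  have bij: "bij_betw g A {1..card A}"
    using g by (simp add: nondecreasing_bijections_def)
  have mono: "g a \<le> g b" if "(a, b) \<in> s" for a b
    using g sA that by (auto simp: nondecreasing_bijections_def)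
  show thesis
  proof
    show "bij_betw g A {1..card A}" by (fact bij)
    show "g a \<le> g b" if "(a, b) \<in> r" for a b
      using mono that by (simp add: s_def)
    fix k assume k: "k \<in> {1..n}"
    have kA: "\<beta> k \<in> A" using \<beta> k by auto
    have top: "\<beta> j \<in> under r (\<beta> j)" if "j \<in> {1..n}" for j
      using \<beta> that rf by (auto simp: under_def refl_on_def image_subset_iff)
    have bk: "block (\<beta> k) = k" using k top by (intro block_eq) auto
    \<comment> \<open>Within its own block \<open>\<beta> k\<close> is the greatest element; with
      every other block it is comparable through \<open>s\<close>.\<close>
    have same: "(a, \<beta> k) \<in> r" if "block a = k" for a
      using block_cases[of a] k that by (auto simp: under_def)
    have "g (\<beta> k) = card (under s (\<beta> k))"
    proof (rule rank_eq_card_under[OF sA bij mono kA])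
      show "(a, \<beta> k) \<in> s \<or> (\<beta> k, a) \<in> s" if "a \<in> A" for a
        using that kA bk same[of a] by (cases "block a" k rule: linorder_cases) (auto simp: s_def)
      show "(\<beta> k, \<beta> k) \<in> s" using same bk by (simp add: s_def)
    qed
    also have "under s (\<beta> k) = (\<Union>j\<in>{1..k}. under r (\<beta> j))"
    proof (intro equalityI subsetI)
      fix a assume "a \<in> under s (\<beta> k)"
      then have "block a \<le> k"
        using block_mono[of a "\<beta> k"] bk by (auto simp: under_def s_def)
      then show "a \<in> (\<Union>j\<in>{1..k}. under r (\<beta> j))"
        using block_cases[of a] k by auto
    next
      fix a assume "a \<in> (\<Union>j\<in>{1..k}. under r (\<beta> j))"
      then obtain j where j: "j \<in> {1..k}" "a \<in> under r (\<beta> j)" by blast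
      then have "block a = j" using k by (intro block_eq) auto
      then show "a \<in> under s (\<beta> k)"
        using j same[of a] kA rA bk by (cases "j = k") (auto simp: under_def s_def)
    qed
    also have "card \<dots> = (\<Sum>j=1..k. card (under r (\<beta> j)))"
    proof (rule card_UN_disjoint)
      have "under r c \<subseteq> A" for c
        using rA by (auto simp: under_def)
      then show "\<forall>j\<in>{1..k}. finite (under r (\<beta> j))"
        using fin finite_subset by blast
      show "\<forall>i\<in>{1..k}. \<forall>j\<in>{1..k}. i \<noteq> j \<longrightarrow> under r (\<beta> i) \<inter> under r (\<beta> j) = {}"
        using disj k by (auto simp: disjoint_family_on_def)
    qed simp
    finally show "g (\<beta> k) = (\<Sum>j=1..k. card (under r (\<beta> j)))" .
  qed
qed

section \<open>Extremal sums for a compatible order\<close>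

text \<open>Since \<open>h\<close> lists \<open>X\<close> increasingly with respect to
  \<open>le\<close>, members of \<open>F\<close> correspond to order-preserving numberings of
  \<open>A\<close> by \<open>{1..card A}\<close>, to which the rank estimates apply. Keeping
  \<open>le\<close> abstract lets one argument serve both the minimum and the maximum.\<close>

lemma semigroup_sum_extremal:
  fixes le :: "'b::ab_semigroup_add \<Rightarrow> 'b \<Rightarrow> bool" and \<beta> :: "nat \<Rightarrow> 'a"
  assumes refl: "reflp le" and trans: "transp le"
    and add: "\<And>x y z. le (x + z) (y + z) \<longleftrightarrow> le x y"
    and fin: "finite A" and po: "partial_order_on A r"
    and h: "bij_betw h {1..card A} X"
      "\<forall>i\<in>{1..card A}. \<forall>j\<in>{1..card A}. le (h i) (h j) \<longleftrightarrow> i \<le> j"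
    and n: "1 \<le> n" and \<beta>: "\<beta> ` {1..n} \<subseteq> A"
    and card_mono: "mono_on {1..n} (\<lambda>k. card (under r (\<beta> k)))"
    and disj: "disjoint_family_on (\<lambda>k. under r (\<beta> k)) {1..n}"
  defines "F \<equiv> {f \<in> A \<rightarrow>\<^sub>E X. bij_betw f A X \<and> (\<forall>a\<in>A. \<forall>b\<in>A. (a, b) \<in> r \<longrightarrow> le (f a) (f b))}"
    and "V \<equiv> semigroup_sum (\<lambda>k. h (\<Sum>j=1..k. card (under r (\<beta> j)))) n"
  shows "\<exists>f\<in>F. semigroup_sum (\<lambda>k. f (\<beta> k)) n = V"
    and "\<And>f. f \<in> F \<Longrightarrow> le V (semigroup_sum (\<lambda>k. f (\<beta> k)) n)"
proof -
  obtain g :: "'a \<Rightarrow> nat" where g: "bij_betw g A {1..card A}"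
      "\<And>a b. (a, b) \<in> r \<Longrightarrow> g a \<le> g b"
      "\<And>k. k \<in> {1..n} \<Longrightarrow> g (\<beta> k) = (\<Sum>j=1..k. card (under r (\<beta> j)))"
    using obtain_block_numbering[OF fin po \<beta> disj] by blast
  \<comment> \<open>The block numbering gives each \<open>\<beta> k\<close> exactly the rank
    required by \<open>V\<close>.\<close>
  define f where "f = restrict (\<lambda>a. h (g a)) A"
  have gA: "g a \<in> {1..card A}" if "a \<in> A" for a
    using g(1) that by (auto simp: bij_betw_def)
  have bf: "bij_betw f A X"
    using bij_betw_trans[OF g(1) h(1)] unfolding f_def by (subst bij_betw_restrict_eq) (simp add: comp_def)
  moreover have "f \<in> A \<rightarrow>\<^sub>E X"
    using bf by (auto simp: f_def bij_betw_def)
  ultimately have "f \<in> F"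
    using g(2) h(2) gA by (simp add: F_def f_def)
  moreover have "semigroup_sum (\<lambda>k. f (\<beta> k)) n = V"
    unfolding V_def using n \<beta> g(3) by (intro semigroup_sum_cong) (auto simp: f_def image_subset_iff)
  ultimately show "\<exists>f\<in>F. semigroup_sum (\<lambda>k. f (\<beta> k)) n = V" by blast
next
  fix f assume f: "f \<in> F"
  have rA: "r \<subseteq> A \<times> A" and rf: "refl_on A r"
    using po by (auto simp: partial_order_on_def preorder_on_def)
  \<comment> \<open>\<open>g a\<close> is the rank of \<open>f a\<close> in
    \<open>X\<close>.\<close>
  define g where "g = (\<lambda>a. the_inv_into {1..card A} h (f a))"
  have bf: "bij_betw f A X" using f by (simp add: F_def)
  have bg: "bij_betw g A {1..card A}"
    using bij_betw_trans[OF bf bij_betw_the_inv_into[OF h(1)]] by (simp add: g_def comp_def)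
  have gA: "g a \<in> {1..card A}" if "a \<in> A" for a
    using bg that by (auto simp: bij_betw_def)
  have hg: "h (g a) = f a" if "a \<in> A" for a
    unfolding g_def using h(1) bf that by (intro f_the_inv_into_f_bij_betw) (auto simp: bij_betw_def)
  have g_mono: "g a \<le> g b" if "(a, b) \<in> r" for a b
  proof -
    have ab: "a \<in> A" "b \<in> A" using rA that by auto
    then have "le (h (g a)) (h (g b))"
      using f that by (simp add: F_def hg)
    then show ?thesis using h(2) gA ab by blast
  qed
  \<comment> \<open>The start value \<open>?z\<close> is arbitrary; it serves only to make
    \<open>sum_from\<close> applicable.\<close>
  let ?p = "\<lambda>k. card (under r (\<beta> k))" and ?z = "f (\<beta> 1)"
  have "le (sum_from ?z (\<lambda>k. h (\<Sum>j=1..k. ?p j)) {1..card {1..n}})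
           (sum_from ?z (\<lambda>k. h (g (\<beta> k))) {1..n})"
  proof (rule sum_from_le_if_rank_ge[where N = "card A" and m = n, OF refl trans])
    show "?p j \<ge> 1" if "j \<in> {1..n}" for j
    proof -
      have "\<beta> j \<in> under r (\<beta> j)"
        using that \<beta> rf by (auto simp: under_def refl_on_def image_subset_iff)
      moreover have "finite (under r (\<beta> j))"
        using rA fin by (auto simp: under_def intro: finite_subset[of _ A])
      ultimately have "?p j > 0" by (auto simp: card_gt_0_iff)
      then show ?thesis by simp
    qed
    show "(\<Sum>j\<in>{j\<in>{1..n}. g (\<beta> j) \<le> g (\<beta> i)}. ?p j) \<le> g (\<beta> i)" if "i \<in> {1..n}" for i
      using \<beta> that by (intro sum_card_under_le_rank[OF fin rA bg g_mono disj]) auto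
  qed (use add h(2) card_mono gA \<beta> in auto)
  \<comment> \<open>Both sums have the form \<open>semigroup_sum ... + ?z\<close>, and the
    equivalence \<open>add\<close>, read from left to right, cancels \<open>?z\<close>.\<close>
  then have "le V (semigroup_sum (\<lambda>k. h (g (\<beta> k))) n)"
    unfolding V_def card_atLeastAtMost diff_Suc_1 sum_from_atLeast1[OF n] add .
  moreover have "semigroup_sum (\<lambda>k. h (g (\<beta> k))) n = semigroup_sum (\<lambda>k. f (\<beta> k)) n"
    using n \<beta> hg by (intro semigroup_sum_cong) (auto simp: image_subset_iff)
  ultimately show "le V (semigroup_sum (\<lambda>k. f (\<beta> k)) n)" by simp
qed

section \<open>Minimum and maximum\<close>

theorem corollary2:
  fixes A :: "'a set" and r :: "'a rel" and N n :: nat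
    and \<xi> :: "nat \<Rightarrow> 'b::{linorder, ab_semigroup_add}" and \<beta> :: "nat \<Rightarrow> 'a"
  assumes "\<And>x y z :: 'b. x < y \<Longrightarrow> x + z < y + z"
    and "finite A" and "card A = N" and "partial_order_on A r"
    and "strict_mono_on {1..N} \<xi>"
    and "1 \<le> n" and "n \<le> N"
    and "inj_on \<beta> {1..n}" and "\<beta> ` {1..n} \<subseteq> A"
  defines "F \<equiv> nondecreasing_bijections A r (\<xi> ` {1..N})"
    and "S \<equiv> (\<lambda>f :: 'a \<Rightarrow> 'b. semigroup_sum (\<lambda>k. f (\<beta> k)) n)"
  shows "(mono_on {1..n} (\<lambda>k. card (under r (\<beta> k))) \<and>
          disjoint_family_on (\<lambda>k. under r (\<beta> k)) {1..n} \<longrightarrow>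
          Min (S ` F) = semigroup_sum (\<lambda>k. \<xi> (\<Sum>j=1..k. card (under r (\<beta> j)))) n)
       \<and> (mono_on {1..n} (\<lambda>k. card (above r (\<beta> k))) \<and>
          disjoint_family_on (\<lambda>k. above r (\<beta> k)) {1..n} \<longrightarrow>
          Max (S ` F) = semigroup_sum (\<lambda>k. \<xi> (N - (\<Sum>j=1..k. card (above r (\<beta> j))) + 1)) n)"
proof (intro conjI impI; elim conjE)
  have inj: "inj_on \<xi> {1..N}"
    using assms(5) by (rule strict_mono_on_imp_inj_on)
  have \<xi>_le: "\<xi> i \<le> \<xi> j \<longleftrightarrow> i \<le> j" if "i \<in> {1..N}" "j \<in> {1..N}" for i j
    using strict_mono_on_leD[OF assms(5)] strict_mono_onD[OF assms(5)] that by (metis not_le)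
  \<comment> \<open>Linearity turns strict monotonicity of addition into an equivalence, which
    contains the cancellation needed to remove the start value.\<close>
  have add_le: "x + z \<le> y + z \<longleftrightarrow> x \<le> y" for x y z :: 'b
    using assms(1) by (metis leD le_less not_le)
  have fin: "finite (S ` F)"
    unfolding F_def using assms(2) by (intro finite_imageI finite_nondecreasing_bijections) auto
  {
    assume mono: "mono_on {1..n} (\<lambda>k. card (under r (\<beta> k)))"
      and disj: "disjoint_family_on (\<lambda>k. under r (\<beta> k)) {1..n}"
    have bij: "bij_betw \<xi> {1..card A} (\<xi> ` {1..N})"
      using inj assms(3) by (simp add: inj_on_imp_bij_betw)
    have \<xi>_le': "\<forall>i\<in>{1..card A}. \<forall>j\<in>{1..card A}. \<xi> i \<le> \<xi> j \<longleftrightarrow> i \<le> j"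
      using \<xi>_le assms(3) by simp
    note ext = semigroup_sum_extremal[where le = "(\<le>)",
        OF reflp_on_le transp_on_le add_le assms(2,4) bij \<xi>_le' assms(6,9) mono disj,
        folded nondecreasing_bijections_def F_def]
    show "Min (S ` F) = semigroup_sum (\<lambda>k. \<xi> (\<Sum>j=1..k. card (under r (\<beta> j)))) n"
    proof (rule Min_eqI[OF fin])
      show "semigroup_sum (\<lambda>k. \<xi> (\<Sum>j=1..k. card (under r (\<beta> j)))) n \<in> S ` F"
        using ext(1) unfolding S_def image_iff by metis
    qed (use ext(2) in \<open>auto simp: S_def\<close>)
  next
    assume mono: "mono_on {1..n} (\<lambda>k. card (above r (\<beta> k)))"
      and disj: "disjoint_family_on (\<lambda>k. above r (\<beta> k)) {1..n}"
    \<comment> \<open>\<open>N - i + 1\<close> is the reversal of \<open>{1..N}\<close>, so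
      \<open>h\<close> lists the values downwards, which is increasingly for the dual order.\<close>
    define h where "h i = \<xi> (N - i + 1)" for i
    have above: "above r b = under (r\<inverse>) b" for b
      by (simp add: above_def under_def)
    have "bij_betw (\<lambda>i. N - i + 1) {1..N} {1..N}"
      by (rule bij_betw_byWitness[where f' = "\<lambda>i. N - i + 1"]) auto
    then have bij: "bij_betw h {1..card A} (\<xi> ` {1..N})"
      using bij_betw_trans[OF _ inj_on_imp_bij_betw[OF inj]] assms(3)
      unfolding h_def comp_def by blast
    have h_le: "\<forall>i\<in>{1..card A}. \<forall>j\<in>{1..card A}. h i \<ge> h j \<longleftrightarrow> i \<le> j"
    proof (intro ballI)
      fix i j assume "i \<in> {1..card A}" "j \<in> {1..card A}"
      then show "h i \<ge> h j \<longleftrightarrow> i \<le> j"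
        unfolding h_def using assms(3) by (subst \<xi>_le) auto
    qed
    have po: "partial_order_on A (r\<inverse>)" using assms(4) by simp
    \<comment> \<open>Reversing both the relation on \<open>A\<close> and the order of the values
      leaves the set of admissible maps unchanged.\<close>
    have F: "F = {f \<in> A \<rightarrow>\<^sub>E \<xi> ` {1..N}. bij_betw f A (\<xi> ` {1..N}) \<and>
        (\<forall>a\<in>A. \<forall>b\<in>A. (a, b) \<in> r\<inverse> \<longrightarrow> f a \<ge> f b)}"
      by (auto simp: F_def nondecreasing_bijections_def)
    note ext = semigroup_sum_extremal[where le = "(\<ge>)",
        OF reflp_on_ge transp_on_ge add_le assms(2) po bij h_le assms(6,9) mono[unfolded above] disj[unfolded above],
        folded F above]
    show "Max (S ` F) = semigroup_sum (\<lambda>k. \<xi> (N - (\<Sum>j=1..k. card (above r (\<beta> j))) + 1)) n"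
    proof (rule Max_eqI[OF fin])
      show "semigroup_sum (\<lambda>k. \<xi> (N - (\<Sum>j=1..k. card (above r (\<beta> j))) + 1)) n \<in> S ` F"
        using ext(1) unfolding S_def h_def image_iff by metis
    qed (use ext(2) in \<open>auto simp: S_def h_def\<close>)
  }
qed

end
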